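(* Let $f:\mathbb{R}^n\to\mathbb{R}^n$ be a polynomial map and let $\mathbb{X}\subset\mathbb{R}^n$ be a compact basic semialgebraic set, $\mathbb{X}=\{x\in\mathbb{R}^n : \varphi_0(x)\ge 0\}$ with $\varphi_0:\mathbb{R}^n\to\mathbb{R}^m$ a polynomial map. For $X\subseteq\mathbb{R}^n$ put $F^{-1}_{\mathbb{X}}(X)=\{x\in\mathbb{X} : f(x)\in X\}$, and define the sequence of sets $\{X_k\}_{k\in\mathbb{N}}$ by $X_0=\mathbb{X}$ and $X_{k+1}=F^{-1}_{\mathbb{X}}(X_k)$ for all $k\in\mathbb{N}$. Then: (a) the sequence is monotonically nonincreasing, i.e. $X_{k+1}\subseteq X_k$ for all $k\in\mathbb{N}$; (b) for every $k\in\mathbb{N}$, $X_k$ is compact (possibly empty); (c) for every $k\in\mathbb{N}$, $X_k$ is basic semialgebraic.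
   Context: $\mathbb{N}$ denotes the nonnegative integers. A map $g:\mathbb{R}^n\to\mathbb{R}^p$ is polynomial if each of its components is a polynomial in $n$ variables with real coefficients. Inequalities between vectors are componentwise. A set $X\subseteq\mathbb{R}^n$ is basic semialgebraic if it is the solution set of a finite number of polynomial inequalities, i.e. $X=\{x\in\mathbb{R}^n : \varphi(x)\ge 0\}$ for some polynomial map $\varphi:\mathbb{R}^n\to\mathbb{R}^p$ and some $p$. *)

theory Defs
  imports "HOL-Analysis.Analysis"
begin

(* On real ^ 'n, real_polynomial_function is the closure of linear forms and constants under
   sums and products, i.e. the real polynomials in n variables.  The number p of inequalities is
   existentially quantified and so cannot be a type; a polynomial map into R^p is therefore given
   by its components phi 0, ..., phi (p - 1).  Allowing p = 0 adds no sets, since the whole space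
   is also the solution set of 1 >= 0. *)
definition basic_semialgebraic :: "(real ^ 'n) set \<Rightarrow> bool" where
  "basic_semialgebraic X \<longleftrightarrow>
    (\<exists>(p::nat) (\<phi> :: nat \<Rightarrow> real ^ 'n \<Rightarrow> real).
      (\<forall>i<p. real_polynomial_function (\<phi> i)) \<and> X = {x. \<forall>i<p. \<phi> i x \<ge> 0})"

definition constrained_preimage ::
  "(real ^ 'n) set \<Rightarrow> (real ^ 'n \<Rightarrow> real ^ 'n) \<Rightarrow> (real ^ 'n) set \<Rightarrow> (real ^ 'n) set" where
  "constrained_preimage \<X> f X = {x \<in> \<X>. f x \<in> X}"

primrec preimage_seq ::
  "(real ^ 'n) set \<Rightarrow> (real ^ 'n \<Rightarrow> real ^ 'n) \<Rightarrow> nat \<Rightarrow> (real ^ 'n) set" where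
  "preimage_seq \<X> f 0 = \<X>"
| "preimage_seq \<X> f (Suc k) = constrained_preimage \<X> f (preimage_seq \<X> f k)"

end

theory Submission
  imports Defs
begin

text \<open>
  One step of the recursion is \<open>X \<mapsto> \<X> \<inter> f -` X\<close>. This operator is monotone in \<open>X\<close>, so the
  trivial inclusion \<open>X\<^sub>1 \<subseteq> \<X> = X\<^sub>0\<close> propagates to all later steps. It also preserves both other
  properties: the preimage of a closed set under the continuous map \<open>f\<close> is closed, and a closed
  subset of \<open>\<X>\<close> is compact; the preimage of \<open>{x. \<forall>i<p. \<phi> i x \<ge> 0}\<close> under the polynomial map \<open>f\<close>
  is cut out by the polynomials \<open>\<phi> i \<circ> f\<close>, and intersecting with \<open>\<X>\<close> joins two finite systems of
  inequalities into one.
\<close>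

text \<open>
  Renumbering an arbitrary finite index set by an initial segment of the naturals once and for all
  covers both the components of a vector-valued map and the disjoint union of two systems.
\<close>

lemma basic_semialgebraic_finite_system:
  fixes g :: "'i \<Rightarrow> real ^ 'n \<Rightarrow> real"
  assumes "finite I" and poly: "\<And>i. i \<in> I \<Longrightarrow> real_polynomial_function (g i)"
  shows "basic_semialgebraic {x. \<forall>i\<in>I. g i x \<ge> 0}"
proof -
  obtain h where h: "bij_betw h {..<card I} I"
    using ex_bij_betw_nat_finite[OF \<open>finite I\<close>] unfolding atLeast0LessThan by blast
  have "(\<forall>i\<in>I. g i x \<ge> 0) \<longleftrightarrow> (\<forall>j<card I. (g \<circ> h) j x \<ge> 0)" for x
    using bij_betw_ball[OF h, of "\<lambda>i. g i x \<ge> 0"] by (simp add: Ball_def)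
  then have "{x. \<forall>i\<in>I. g i x \<ge> 0} = {x. \<forall>j<card I. (g \<circ> h) j x \<ge> 0}"
    by (rule Collect_cong)
  moreover have "\<forall>j<card I. real_polynomial_function ((g \<circ> h) j)"
    using bij_betwE[OF h] poly by simp
  ultimately show ?thesis
    unfolding basic_semialgebraic_def by blast
qed

lemma basic_semialgebraic_Int:
  assumes "basic_semialgebraic X" and "basic_semialgebraic Y"
  shows "basic_semialgebraic (X \<inter> Y)"
proof -
  obtain p :: nat and \<phi> where p: "\<forall>i<p. real_polynomial_function (\<phi> i)" "X = {x. \<forall>i<p. \<phi> i x \<ge> 0}"
    using assms(1) unfolding basic_semialgebraic_def by blast
  obtain q :: nat and \<psi> where q: "\<forall>i<q. real_polynomial_function (\<psi> i)" "Y = {x. \<forall>i<q. \<psi> i x \<ge> 0}"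
    using assms(2) unfolding basic_semialgebraic_def by blast
  have "basic_semialgebraic {x. \<forall>i \<in> {..<p} <+> {..<q}. case_sum \<phi> \<psi> i x \<ge> 0}"
  proof (rule basic_semialgebraic_finite_system)
    show "real_polynomial_function (case_sum \<phi> \<psi> i)" if "i \<in> {..<p} <+> {..<q}" for i
      using that by (rule PlusE) (simp_all add: p(1) q(1))
  qed (rule finite_Plus; simp)
  moreover have "X \<inter> Y = {x. \<forall>i \<in> {..<p} <+> {..<q}. case_sum \<phi> \<psi> i x \<ge> 0}"
    unfolding p(2) q(2) Plus_def ball_Un by auto
  ultimately show ?thesis
    by simp
qed

lemma basic_semialgebraic_vimage:
  fixes f :: "real ^ 'n \<Rightarrow> real ^ 'm"
  assumes "polynomial_function f" and "basic_semialgebraic X"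
  shows "basic_semialgebraic (f -` X)"
proof -
  obtain p :: nat and \<phi> where p: "\<forall>i<p. real_polynomial_function (\<phi> i)" "X = {x. \<forall>i<p. \<phi> i x \<ge> 0}"
    using assms(2) unfolding basic_semialgebraic_def by blast
  have "basic_semialgebraic {x. \<forall>i\<in>{..<p}. (\<phi> i \<circ> f) x \<ge> 0}"
    using p(1) assms(1)
    by (intro basic_semialgebraic_finite_system real_polynomial_function_compose) simp_all
  moreover have "f -` X = {x. \<forall>i\<in>{..<p}. (\<phi> i \<circ> f) x \<ge> 0}"
    unfolding p(2) by auto
  ultimately show ?thesis
    by simp
qed

lemma basic_semialgebraic_polynomial_function:
  fixes \<phi> :: "real ^ 'n \<Rightarrow> real ^ 'm"
  assumes "polynomial_function \<phi>"
  shows "basic_semialgebraic {x. \<forall>i. \<phi> x $ i \<ge> 0}"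
proof -
  have "real_polynomial_function (\<lambda>x. \<phi> x $ i)" for i
  proof -
    have "real_polynomial_function ((\<lambda>y. y $ i) \<circ> \<phi>)"
      using assms bounded_linear_vec_nth[of i] unfolding polynomial_function_def by blast
    then show ?thesis
      by (simp only: o_def)
  qed
  then have "basic_semialgebraic {x. \<forall>i\<in>UNIV. \<phi> x $ i \<ge> 0}"
    by (intro basic_semialgebraic_finite_system) simp_all
  then show ?thesis
    by simp
qed

lemma constrained_preimage_eq: "constrained_preimage \<X> f X = \<X> \<inter> f -` X"
  by (auto simp: constrained_preimage_def)

lemma preimage_seq_Suc_subset: "preimage_seq \<X> f (Suc k) \<subseteq> preimage_seq \<X> f k"
  by (induction k) (auto simp: constrained_preimage_def)

lemma compact_preimage_seq:
  assumes "continuous_on UNIV f" and "compact \<X>"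
  shows "compact (preimage_seq \<X> f k)"
proof (induction k)
  case (Suc k)
  then have "closed (f -` preimage_seq \<X> f k)"
    using assms(1) by (intro closed_vimage compact_imp_closed)
  with assms(2) show ?case
    by (simp add: constrained_preimage_eq compact_Int_closed)
qed (use assms(2) in simp)

lemma basic_semialgebraic_preimage_seq:
  assumes "polynomial_function f" and "basic_semialgebraic \<X>"
  shows "basic_semialgebraic (preimage_seq \<X> f k)"
  using assms
  by (induction k)
    (simp_all add: constrained_preimage_eq basic_semialgebraic_Int basic_semialgebraic_vimage)

theorem theorem7:
  fixes f :: "real ^ 'n \<Rightarrow> real ^ 'n"
    and \<phi>0 :: "real ^ 'n \<Rightarrow> real ^ 'm"
    and \<X> :: "(real ^ 'n) set"
  assumes "polynomial_function f"
    and "polynomial_function \<phi>0"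
    and "\<X> = {x. \<forall>i. \<phi>0 x $ i \<ge> 0}"
    and "compact \<X>"
  shows "(\<forall>k. preimage_seq \<X> f (Suc k) \<subseteq> preimage_seq \<X> f k)
    \<and> (\<forall>k. compact (preimage_seq \<X> f k))
    \<and> (\<forall>k. basic_semialgebraic (preimage_seq \<X> f k))"
proof (intro conjI allI)
  fix k
  show "preimage_seq \<X> f (Suc k) \<subseteq> preimage_seq \<X> f k"
    by (rule preimage_seq_Suc_subset)
  show "compact (preimage_seq \<X> f k)"
    using assms(1,4) by (intro compact_preimage_seq continuous_on_polymonial_function)
  show "basic_semialgebraic (preimage_seq \<X> f k)"
    using assms(1,2) unfolding assms(3)
    by (intro basic_semialgebraic_preimage_seq basic_semialgebraic_polynomial_function)
qed

end
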